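(* Let $(\mathcal R,\exp)$ be an exponential field which is o-minimal (as a structure in the language $(+,\cdot,0,1,\leqslant,\exp)$). Let $\mathcal M\subseteq\mathcal R$ be a discretely ordered ring and $x^y\colon M^+\times M^+\to M^+$ a function such that $(\mathcal M,x^y)$ is an $x^y$-integer part of $(\mathcal R,\exp)$. Then $(\mathcal M^+,x^y)$, with $S(x)$ interpreted as $x+1$, is a model of $\mathsf{IOpen}(x^y)$.
   Context: An exponential field is an ordered field $\mathcal F$ with a map $\exp\colon F\to F^{>0}$ that is an order-preserving isomorphism from $(F,+)$ onto $(F^{>0},\cdot)$; $\log$ denotes its inverse. A structure with a dense linear order is o-minimal if every definable (with parameters) subset of its domain is a finite union of intervals and points. A discretely ordered ring is an ordered (commutative unital) ring in which $1$ is the least positive element; $M^+=\{m\in M:m\geqslant0\}$. If $\mathcal M\subseteq\mathcal R$ with $\mathcal M$ discretely ordered, $\mathcal M$ is an integer part of $\mathcal R$ if for each $r\in R$ there is $m\in M$ with $m\leqslant r<m+1$. $(\mathcal M,x^y)$ is an $x^y$-integer part of $(\mathcal R,\exp)$ if $\mathcal M$ is an integer part of $\mathcal R$ and (1) $n^m=\exp(m\cdot\log n)$ for all $n,m\in M^+$ with $n>0$, (2) $0^0=1$, (3) $0^m=0$ for all $m\in M^{>0}$. The theory $\mathsf{IOpen}(x^y)$ in the language $(0,S,+,\cdot,\leqslant,x^y)$ consists of: (Q1) $Sx\neq 0$; (Q2) $Sx=Sy\to x=y$; (Q3) $x\neq0\to\exists y\,(x=Sy)$; (Q4) $x+0=x$;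 (Q5) $x+Sy=S(x+y)$; (Q6) $x\cdot0=0$; (Q7) $x\cdot Sy=x\cdot y+x$; (Q8) $x\leqslant y\leftrightarrow\exists r\,(r+x=y)$; (P1) $x^0=S(0)$; (P2) $y^{S(x)}=y^x\cdot y$; and the induction scheme $\big(\varphi(0,\bar y)\wedge\forall x(\varphi(x,\bar y)\to\varphi(S(x),\bar y))\big)\to\forall x\,\varphi(x,\bar y)$ for every quantifier-free formula $\varphi$ of this language. *)

theory Defs
  imports "HOL-Library.FuncSet"
begin

text \<open>
  First-order formulas over a language whose only relation symbols are equality and \<open>\<le>\<close>, with
  de Bruijn indices: index 0 refers to the innermost quantifier. The type \<open>'t\<close> of terms
  determines the language.
\<close>

datatype 't fm =
    Eq 't 't
  | Le 't 't
  | Neg "'t fm"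
  | Conj "'t fm" "'t fm"
  | Disj "'t fm" "'t fm"
  | Imp "'t fm" "'t fm"
  | All "'t fm"
  | Ex "'t fm"

abbreviation Iff :: "'t fm \<Rightarrow> 't fm \<Rightarrow> 't fm" where
  "Iff p q \<equiv> Conj (Imp p q) (Imp q p)"

primrec quantifier_free :: "'t fm \<Rightarrow> bool" where
  "quantifier_free (Eq s t) \<longleftrightarrow> True"
| "quantifier_free (Le s t) \<longleftrightarrow> True"
| "quantifier_free (Neg p) \<longleftrightarrow> quantifier_free p"
| "quantifier_free (Conj p q) \<longleftrightarrow> quantifier_free p \<and> quantifier_free q"
| "quantifier_free (Disj p q) \<longleftrightarrow> quantifier_free p \<and> quantifier_free q"
| "quantifier_free (Imp p q) \<longleftrightarrow> quantifier_free p \<and> quantifier_free q"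
| "quantifier_free (All p) \<longleftrightarrow> False"
| "quantifier_free (Ex p) \<longleftrightarrow> False"

text \<open>
  Satisfaction in the structure with universe \<open>U\<close>, term evaluation \<open>ev\<close> and order \<open>le\<close>, under the
  assignment \<open>v\<close>. The assignment \<open>case_nat a v\<close> sends 0 to \<open>a\<close> and \<open>Suc i\<close> to \<open>v i\<close>.
\<close>

primrec sat ::
  "'a set \<Rightarrow> ((nat \<Rightarrow> 'a) \<Rightarrow> 't \<Rightarrow> 'a) \<Rightarrow> ('a \<Rightarrow> 'a \<Rightarrow> bool) \<Rightarrow> (nat \<Rightarrow> 'a) \<Rightarrow> 't fm \<Rightarrow> bool" where
  "sat U ev le v (Eq s t) \<longleftrightarrow> ev v s = ev v t"
| "sat U ev le v (Le s t) \<longleftrightarrow> le (ev v s) (ev v t)"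
| "sat U ev le v (Neg p) \<longleftrightarrow> \<not> sat U ev le v p"
| "sat U ev le v (Conj p q) \<longleftrightarrow> sat U ev le v p \<and> sat U ev le v q"
| "sat U ev le v (Disj p q) \<longleftrightarrow> sat U ev le v p \<or> sat U ev le v q"
| "sat U ev le v (Imp p q) \<longleftrightarrow> (sat U ev le v p \<longrightarrow> sat U ev le v q)"
| "sat U ev le v (All p) \<longleftrightarrow> (\<forall>a\<in>U. sat U ev le (case_nat a v) p)"
| "sat U ev le v (Ex p) \<longleftrightarrow> (\<exists>a\<in>U. sat U ev le (case_nat a v) p)"


section \<open>O-minimal exponential fields\<close>

text \<open>The ordered field is the whole type \<open>'a\<close>; \<open>E\<close> is its exponential map.\<close>

definition exponential_field :: "('a::linordered_field \<Rightarrow> 'a) \<Rightarrow> bool" where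
  "exponential_field E \<longleftrightarrow>
     bij_betw E UNIV {0<..} \<and> strict_mono E \<and> (\<forall>x y. E (x + y) = E x * E y)"

definition log_of :: "('a::linordered_field \<Rightarrow> 'a) \<Rightarrow> 'a \<Rightarrow> 'a" where
  "log_of E = inv E"

datatype exp_tm =
    EVar nat
  | EZero
  | EOne
  | EAdd exp_tm exp_tm
  | EMul exp_tm exp_tm
  | EExp exp_tm

primrec exp_tm_val :: "('a::linordered_field \<Rightarrow> 'a) \<Rightarrow> (nat \<Rightarrow> 'a) \<Rightarrow> exp_tm \<Rightarrow> 'a" where
  "exp_tm_val E v (EVar i) = v i"
| "exp_tm_val E v EZero = 0"
| "exp_tm_val E v EOne = 1"
| "exp_tm_val E v (EAdd s t) = exp_tm_val E v s + exp_tm_val E v t"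
| "exp_tm_val E v (EMul s t) = exp_tm_val E v s * exp_tm_val E v t"
| "exp_tm_val E v (EExp t) = E (exp_tm_val E v t)"

text \<open>
  Definability in \<open>(+, \<cdot>, 0, 1, \<le>, exp)\<close>. Index 0 is the variable of the defined set; the remaining
  free variables are assigned the parameters \<open>v\<close>.
\<close>

definition exp_definable :: "('a::linordered_field \<Rightarrow> 'a) \<Rightarrow> 'a set \<Rightarrow> bool" where
  "exp_definable E X \<longleftrightarrow>
     (\<exists>(p :: exp_tm fm) v. X = {a. sat UNIV (exp_tm_val E) (\<le>) (case_nat a v) p})"

text \<open>
  Intervals have endpoints in the field or at \<open>\<plusminus>\<infinity>\<close>; arbitrary convex sets are not admitted.
  Half-open and closed intervals are unions of these open intervals and points.
\<close>

definition open_interval :: "'a::linorder set \<Rightarrow> bool" where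
  "open_interval I \<longleftrightarrow>
     I = UNIV \<or> (\<exists>a. I = {a<..}) \<or> (\<exists>b. I = {..<b}) \<or> (\<exists>a b. I = {a<..<b})"

definition finite_union_of_intervals_and_points :: "'a::linorder set \<Rightarrow> bool" where
  "finite_union_of_intervals_and_points X \<longleftrightarrow>
     (\<exists>F. finite F \<and> (\<forall>I\<in>F. open_interval I \<or> (\<exists>a. I = {a})) \<and> X = \<Union>F)"

definition o_minimal_exp :: "('a::linordered_field \<Rightarrow> 'a) \<Rightarrow> bool" where
  "o_minimal_exp E \<longleftrightarrow> (\<forall>X. exp_definable E X \<longrightarrow> finite_union_of_intervals_and_points X)"


section \<open>Integer parts\<close>

definition discretely_ordered_subring :: "'a::linordered_field set \<Rightarrow> bool" where
  "discretely_ordered_subring M \<longleftrightarrow>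
     0 \<in> M \<and> 1 \<in> M \<and>
     (\<forall>x\<in>M. \<forall>y\<in>M. x + y \<in> M \<and> x * y \<in> M) \<and> (\<forall>x\<in>M. - x \<in> M) \<and>
     (\<forall>x\<in>M. 0 < x \<longrightarrow> 1 \<le> x)"

definition nonneg_part :: "'a::linordered_field set \<Rightarrow> 'a set" where
  "nonneg_part M = {m \<in> M. 0 \<le> m}"

definition integer_part :: "'a::linordered_field set \<Rightarrow> bool" where
  "integer_part M \<longleftrightarrow> (\<forall>r. \<exists>m\<in>M. m \<le> r \<and> r < m + 1)"

definition pow_integer_part ::
  "('a::linordered_field \<Rightarrow> 'a) \<Rightarrow> 'a set \<Rightarrow> ('a \<Rightarrow> 'a \<Rightarrow> 'a) \<Rightarrow> bool" where
  "pow_integer_part E M pw \<longleftrightarrow>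
     integer_part M \<and>
     (\<forall>n\<in>nonneg_part M. \<forall>m\<in>nonneg_part M. 0 < n \<longrightarrow> pw n m = E (m * log_of E n)) \<and>
     pw 0 0 = 1 \<and>
     (\<forall>m\<in>M. 0 < m \<longrightarrow> pw 0 m = 0)"


section \<open>The theory IOpen(x^y)\<close>

datatype arith_tm =
    Var nat
  | Zero
  | Succ arith_tm
  | Add arith_tm arith_tm
  | Mul arith_tm arith_tm
  | Pow arith_tm arith_tm

primrec arith_subst :: "(nat \<Rightarrow> arith_tm) \<Rightarrow> arith_tm \<Rightarrow> arith_tm" where
  "arith_subst s (Var i) = s i"
| "arith_subst s Zero = Zero"
| "arith_subst s (Succ t) = Succ (arith_subst s t)"
| "arith_subst s (Add t u) = Add (arith_subst s t) (arith_subst s u)"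
| "arith_subst s (Mul t u) = Mul (arith_subst s t) (arith_subst s u)"
| "arith_subst s (Pow t u) = Pow (arith_subst s t) (arith_subst s u)"

text \<open>
  The induction axiom for \<open>p\<close> with induction variable 0 and parameters at the indices \<open>Suc i\<close>. The
  first conjunct is outside the quantifier, so there the parameter \<open>Suc i\<close> becomes \<open>i\<close>.
  Applying a substitution with \<^const>\<open>map_fm\<close> is correct only for quantifier-free \<open>p\<close>.
\<close>

definition induction_axiom :: "arith_tm fm \<Rightarrow> arith_tm fm" where
  "induction_axiom p =
     Imp (Conj (map_fm (arith_subst (case_nat Zero Var)) p)
               (All (Imp p (map_fm (arith_subst (case_nat (Succ (Var 0)) (\<lambda>i. Var (Suc i)))) p))))
         (All p)"

definition IOpen_pow :: "arith_tm fm set" where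
  "IOpen_pow =
     { Neg (Eq (Succ (Var 0)) Zero),
       Imp (Eq (Succ (Var 0)) (Succ (Var 1))) (Eq (Var 0) (Var 1)),
       Imp (Neg (Eq (Var 0) Zero)) (Ex (Eq (Var 1) (Succ (Var 0)))),
       Eq (Add (Var 0) Zero) (Var 0),
       Eq (Add (Var 0) (Succ (Var 1))) (Succ (Add (Var 0) (Var 1))),
       Eq (Mul (Var 0) Zero) Zero,
       Eq (Mul (Var 0) (Succ (Var 1))) (Add (Mul (Var 0) (Var 1)) (Var 0)),
       Iff (Le (Var 0) (Var 1)) (Ex (Eq (Add (Var 0) (Var 1)) (Var 2))),
       Eq (Pow (Var 0) Zero) (Succ Zero),
       Eq (Pow (Var 1) (Succ (Var 0))) (Mul (Pow (Var 1) (Var 0)) (Var 1)) }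
     \<union> {induction_axiom p |p. quantifier_free p}"

record 'a arith_structure =
  dom :: "'a set"
  zero :: 'a
  succ :: "'a \<Rightarrow> 'a"
  add :: "'a \<Rightarrow> 'a \<Rightarrow> 'a"
  mul :: "'a \<Rightarrow> 'a \<Rightarrow> 'a"
  pow :: "'a \<Rightarrow> 'a \<Rightarrow> 'a"
  leq :: "'a \<Rightarrow> 'a \<Rightarrow> bool"

definition is_arith_structure :: "'a arith_structure \<Rightarrow> bool" where
  "is_arith_structure A \<longleftrightarrow>
     zero A \<in> dom A \<and>
     succ A \<in> dom A \<rightarrow> dom A \<and>
     add A \<in> dom A \<rightarrow> dom A \<rightarrow> dom A \<and>
     mul A \<in> dom A \<rightarrow> dom A \<rightarrow> dom A \<and>
     pow A \<in> dom A \<rightarrow> dom A \<rightarrow> dom A"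

primrec arith_val :: "'a arith_structure \<Rightarrow> (nat \<Rightarrow> 'a) \<Rightarrow> arith_tm \<Rightarrow> 'a" where
  "arith_val A v (Var i) = v i"
| "arith_val A v Zero = zero A"
| "arith_val A v (Succ t) = succ A (arith_val A v t)"
| "arith_val A v (Add t u) = add A (arith_val A v t) (arith_val A v u)"
| "arith_val A v (Mul t u) = mul A (arith_val A v t) (arith_val A v u)"
| "arith_val A v (Pow t u) = pow A (arith_val A v t) (arith_val A v u)"

text \<open>Free variables of an axiom are read universally.\<close>

definition arith_model :: "'a arith_structure \<Rightarrow> arith_tm fm set \<Rightarrow> bool" where
  "arith_model A T \<longleftrightarrow>
     is_arith_structure A \<and>
     (\<forall>p\<in>T. \<forall>v. range v \<subseteq> dom A \<longrightarrow> sat (dom A) (arith_val A) (leq A) v p)"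

definition nonneg_structure ::
  "'a::linordered_field set \<Rightarrow> ('a \<Rightarrow> 'a \<Rightarrow> 'a) \<Rightarrow> 'a arith_structure" where
  "nonneg_structure M pw =
     \<lparr> dom = nonneg_part M, zero = 0, succ = (\<lambda>x. x + 1), add = (+), mul = (*), pow = pw,
       leq = (\<le>) \<rparr>"

end

theory Submission imports Defs
begin

text \<open>
  Extend \<open>x\<^sup>y\<close> to the whole field by \<open>exp (y \<cdot> log x)\<close> for \<open>x > 0\<close>. A quantifier-free formula
  \<open>\<phi>(x, y)\<close> over \<open>M\<^sup>+\<close> then agrees on \<open>M\<^sup>+\<close> with a formula of \<open>(\<R>, exp)\<close>, whose set of
  counterexamples is by o-minimality a finite union of intervals and points. Because \<open>M\<close> is an
  integer part, every interval that meets \<open>M\<^sup>+\<close> contains a least element of \<open>M\<^sup>+\<close>. So a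
  formula that fails somewhere on \<open>M\<^sup>+\<close> fails at a least element, which is impossible under the
  hypotheses of induction.
\<close>

section \<open>Extension of x^y to the field and its definability from exp\<close>

lemma exponential_field_laws:
  assumes "exponential_field E"
  shows "E 0 = 1" "E x > 0" "0 < y \<Longrightarrow> E (log_of E y) = y"
    "log_of E (E x) = x" "E (x + z) = E x * E z"
proof -
  have bij: "bij_betw E UNIV {0<..}" and mono: "strict_mono E"
    and add: "\<And>x y. E (x + y) = E x * E y"
    using assms by (auto simp: exponential_field_def)
  show pos: "E x > 0" for x
    using bij by (auto simp: bij_betw_def)
  show "E (x + z) = E x * E z"
    by (rule add)
  have "E 0 * E 0 = E 0 * 1"
    using add[of 0 0] by simp
  then show "E 0 = 1"
    using pos[of 0] by (metis less_irrefl mult_left_cancel)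
  show "0 < y \<Longrightarrow> E (log_of E y) = y"
    using bij by (auto simp: log_of_def bij_betw_def f_inv_into_f)
  show "log_of E (E x) = x"
    using bij by (simp add: log_of_def bij_betw_def)
qed

text \<open>For a base that is not positive, the conventions 0^0 = 1 and 0^m = 0 are copied, so the
  power is total and agrees with \<open>pw\<close> on M^+. Negative bases are treated like 0, which
  keeps positivity as the only case split on the base.\<close>

definition ext_structure :: "('a::linordered_field \<Rightarrow> 'a) \<Rightarrow> 'a arith_structure" where
  "ext_structure E =
     \<lparr> dom = UNIV, zero = 0, succ = (\<lambda>x. x + 1), add = (+), mul = (*),
       pow = (\<lambda>x y. if 0 < x then E (y * log_of E x) else if y = 0 then 1 else 0),
       leq = (\<le>) \<rparr>"

text \<open>The language of (R, exp) has no logarithm: a witness \<open>l\<close> with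
  \<open>x = E l\<close> stands for log x. As exp maps onto the positive elements, such a witness
  exists exactly when x > 0.\<close>

lemma pow_ext_structure_graph:
  assumes "exponential_field E"
  shows "z = pow (ext_structure E) x y \<longleftrightarrow>
    (\<exists>l. x = E l \<and> z = E (y * l)) \<or> (\<not> (\<exists>l. x = E l)) \<and> (y = 0 \<and> z = 1 \<or> y \<noteq> 0 \<and> z = 0)"
proof (cases "0 < x")
  case True
  then obtain l where "x = E l"
    using exponential_field_laws(3)[OF assms] by metis
  then show ?thesis
    using True exponential_field_laws(4)[OF assms] by (auto simp: ext_structure_def) metis
next
  case False
  then have "\<not> (\<exists>l. x = E l)"
    using exponential_field_laws(2)[OF assms] by auto
  then show ?thesis
    using False by (auto simp: ext_structure_def)
qed

text \<open>
  \<open>term_graph t r \<rho>\<close> says that the variable \<open>r\<close> is the value of \<open>t\<close>, the variable \<open>i\<close> of \<open>t\<close> being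
  read at \<open>\<rho> i\<close>. Carrying \<open>\<rho>\<close> along avoids renaming formulas under quantifiers.
\<close>

primrec term_graph :: "arith_tm \<Rightarrow> nat \<Rightarrow> (nat \<Rightarrow> nat) \<Rightarrow> exp_tm fm" where
  "term_graph (Var i) r \<rho> = Eq (EVar r) (EVar (\<rho> i))"
| "term_graph Zero r \<rho> = Eq (EVar r) EZero"
| "term_graph (Succ t) r \<rho> =
     Ex (Conj (term_graph t 0 (\<lambda>i. Suc (\<rho> i))) (Eq (EVar (Suc r)) (EAdd (EVar 0) EOne)))"
| "term_graph (Add t u) r \<rho> =
     Ex (Ex (Conj (term_graph t 1 (\<lambda>i. Suc (Suc (\<rho> i))))
       (Conj (term_graph u 0 (\<lambda>i. Suc (Suc (\<rho> i))))
         (Eq (EVar (Suc (Suc r))) (EAdd (EVar 1) (EVar 0))))))"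
| "term_graph (Mul t u) r \<rho> =
     Ex (Ex (Conj (term_graph t 1 (\<lambda>i. Suc (Suc (\<rho> i))))
       (Conj (term_graph u 0 (\<lambda>i. Suc (Suc (\<rho> i))))
         (Eq (EVar (Suc (Suc r))) (EMul (EVar 1) (EVar 0))))))"
| "term_graph (Pow t u) r \<rho> =
     Ex (Ex (Conj (term_graph t 1 (\<lambda>i. Suc (Suc (\<rho> i))))
       (Conj (term_graph u 0 (\<lambda>i. Suc (Suc (\<rho> i))))
         (Disj
           (Ex (Conj (Eq (EVar 2) (EExp (EVar 0)))
             (Eq (EVar (Suc (Suc (Suc r)))) (EExp (EMul (EVar 1) (EVar 0))))))
           (Conj (Neg (Ex (Eq (EVar 2) (EExp (EVar 0)))))
             (Disj (Conj (Eq (EVar 0) EZero) (Eq (EVar (Suc (Suc r))) EOne))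
               (Conj (Neg (Eq (EVar 0) EZero)) (Eq (EVar (Suc (Suc r))) EZero))))))))"

text \<open>Induction on \<open>t\<close> with \<open>v\<close>, \<open>r\<close> and
  \<open>\<rho>\<close> arbitrary, since the subterm graphs sit below quantifiers, where the
  assignment is extended and the indices are shifted.\<close>

lemma sat_term_graph:
  assumes "exponential_field E"
  shows "sat UNIV (exp_tm_val E) (\<le>) v (term_graph t r \<rho>) \<longleftrightarrow>
    v r = arith_val (ext_structure E) (\<lambda>i. v (\<rho> i)) t"
proof (induction t arbitrary: v r \<rho>)
  case (Pow t u)
  show ?case
    by (simp add: Pow pow_ext_structure_graph[OF assms] numeral_2_eq_2)
qed (simp_all add: ext_structure_def)

text \<open>An atom becomes an existential statement about the values of its two terms, given by
  their graphs; connectives carry over. The domain \<open>U\<close> is arbitrary because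
  \<open>p\<close> has no quantifiers, while those of \<open>q\<close> range over the field.\<close>

lemma sat_ext_structure_exp_definable:
  assumes "exponential_field E" "quantifier_free p"
  shows "\<exists>q. \<forall>v. sat UNIV (exp_tm_val E) (\<le>) v q \<longleftrightarrow> sat U (arith_val (ext_structure E)) (\<le>) v p"
  using assms(2)
proof (induction p)
  case (Eq s t)
  let ?q = "Ex (Ex (Conj (term_graph s 1 (\<lambda>i. Suc (Suc i)))
    (Conj (term_graph t 0 (\<lambda>i. Suc (Suc i))) (Eq (EVar 1) (EVar 0)))))"
  show ?case
    by (rule exI[of _ ?q]) (simp add: sat_term_graph[OF assms(1)])
next
  case (Le s t)
  let ?q = "Ex (Ex (Conj (term_graph s 1 (\<lambda>i. Suc (Suc i)))
    (Conj (term_graph t 0 (\<lambda>i. Suc (Suc i))) (Le (EVar 1) (EVar 0)))))"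
  show ?case
    by (rule exI[of _ ?q]) (simp add: sat_term_graph[OF assms(1)])
next
  case (Neg p)
  then obtain q where
    "\<forall>v. sat UNIV (exp_tm_val E) (\<le>) v q \<longleftrightarrow> sat U (arith_val (ext_structure E)) (\<le>) v p"
    by auto
  then show ?case
    by (intro exI[of _ "Neg q"]) simp
next
  case (Conj p p')
  then obtain q q' where
    "\<forall>v. sat UNIV (exp_tm_val E) (\<le>) v q \<longleftrightarrow> sat U (arith_val (ext_structure E)) (\<le>) v p"
    "\<forall>v. sat UNIV (exp_tm_val E) (\<le>) v q' \<longleftrightarrow> sat U (arith_val (ext_structure E)) (\<le>) v p'"
    by auto
  then show ?case
    by (intro exI[of _ "Conj q q'"]) simp
next
  case (Disj p p')
  then obtain q q' where
    "\<forall>v. sat UNIV (exp_tm_val E) (\<le>) v q \<longleftrightarrow> sat U (arith_val (ext_structure E)) (\<le>) v p"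
    "\<forall>v. sat UNIV (exp_tm_val E) (\<le>) v q' \<longleftrightarrow> sat U (arith_val (ext_structure E)) (\<le>) v p'"
    by auto
  then show ?case
    by (intro exI[of _ "Disj q q'"]) simp
next
  case (Imp p p')
  then obtain q q' where
    "\<forall>v. sat UNIV (exp_tm_val E) (\<le>) v q \<longleftrightarrow> sat U (arith_val (ext_structure E)) (\<le>) v p"
    "\<forall>v. sat UNIV (exp_tm_val E) (\<le>) v q' \<longleftrightarrow> sat U (arith_val (ext_structure E)) (\<le>) v p'"
    by auto
  then show ?case
    by (intro exI[of _ "Imp q q'"]) simp
qed simp_all

section \<open>Substitution and closure of term values\<close>

lemma arith_val_subst:
  "arith_val A v (arith_subst s t) = arith_val A (\<lambda>i. arith_val A v (s i)) t"
  by (induction t) simp_all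

lemma sat_map_fm_arith_subst:
  "quantifier_free p \<Longrightarrow> sat U (arith_val A) le v (map_fm (arith_subst s) p) \<longleftrightarrow>
    sat U (arith_val A) le (\<lambda>i. arith_val A v (s i)) p"
  by (induction p) (simp_all add: arith_val_subst)

lemma arith_val_in_dom:
  assumes "is_arith_structure A" "range v \<subseteq> dom A"
  shows "arith_val A v t \<in> dom A"
  by (induction t) (use assms in \<open>auto simp: is_arith_structure_def Pi_iff\<close>)

section \<open>Least elements of M^+ in intervals\<close>

lemma discretely_ordered_subring_diff:
  assumes "discretely_ordered_subring M" "x \<in> M" "y \<in> M"
  shows "x - y \<in> M"
proof -
  have "x + - y \<in> M"
    using assms unfolding discretely_ordered_subring_def by blast
  then show ?thesis
    by simp
qed

lemma discretely_ordered_subring_succ_le: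
  assumes "discretely_ordered_subring M" "m \<in> M" "n \<in> M" "m < n"
  shows "m + 1 \<le> n"
proof -
  have "n - m \<in> M" "0 < n - m"
    using assms by (simp_all add: discretely_ordered_subring_diff)
  then have "1 \<le> n - m"
    using assms(1) unfolding discretely_ordered_subring_def by blast
  then show ?thesis
    by (simp add: algebra_simps)
qed

lemma nonneg_part_diff_one:
  assumes M: "discretely_ordered_subring M" and "x \<in> nonneg_part M" "x \<noteq> 0"
  shows "x - 1 \<in> nonneg_part M"
proof -
  have "x \<in> M" "0 < x" "0 \<in> M" "1 \<in> M"
    using assms by (auto simp: nonneg_part_def discretely_ordered_subring_def)
  then show ?thesis
    using discretely_ordered_subring_succ_le[OF M, of 0 x] discretely_ordered_subring_diff[OF M]
    by (simp add: nonneg_part_def)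
qed

text \<open>If a < 0, the element is 0. Otherwise it is n + 1 for the integer part n of a: an
  element of M above a exceeds n, so by discreteness it is at least n + 1.\<close>

lemma nonneg_part_greater_least:
  fixes a :: "'a::linordered_field"
  assumes M: "discretely_ordered_subring M" and "integer_part M"
  obtains m where "m \<in> nonneg_part M" "a < m" "\<And>k. k \<in> nonneg_part M \<Longrightarrow> a < k \<Longrightarrow> m \<le> k"
proof (cases "a < 0")
  case True
  have "0 \<in> nonneg_part M"
    using M by (simp add: discretely_ordered_subring_def nonneg_part_def)
  then show ?thesis
    by (rule that) (use True in \<open>simp_all add: nonneg_part_def\<close>)
next
  case False
  obtain n where n: "n \<in> M" "n \<le> a" "a < n + 1"
    using assms(2) unfolding integer_part_def by blast
  have "n + 1 \<in> nonneg_part M"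
    using M n False by (auto simp: discretely_ordered_subring_def nonneg_part_def)
  moreover have "n + 1 \<le> k" if "k \<in> nonneg_part M" "a < k" for k
    using discretely_ordered_subring_succ_le[OF M n(1), of k] that n(2)
    by (auto simp: nonneg_part_def)
  ultimately show ?thesis
    using that[of "n + 1"] n(3) by blast
qed

text \<open>Without a lower endpoint, the interval contains 0 as soon as it meets M^+. With lower
  endpoint a, the least element of M^+ above a lies below every element of M^+ in the interval,
  hence also below the upper endpoint.\<close>

lemma nonneg_part_interval_least:
  assumes M: "discretely_ordered_subring M" "integer_part M"
    and I: "open_interval I \<or> (\<exists>a. I = {a})" and ne: "I \<inter> nonneg_part M \<noteq> {}"
  shows "\<exists>m \<in> I \<inter> nonneg_part M. \<forall>k \<in> I \<inter> nonneg_part M. m \<le> k"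
proof -
  have zero: "0 \<in> nonneg_part M"
    using M by (simp add: discretely_ordered_subring_def nonneg_part_def)
  have nonneg: "0 \<le> k" if "k \<in> nonneg_part M" for k
    using that by (simp add: nonneg_part_def)
  consider "I = UNIV" | b where "I = {..<b}" | a where "I = {a<..}" | a b where "I = {a<..<b}"
    | a where "I = {a}"
    using I by (auto simp: open_interval_def)
  then show ?thesis
  proof cases
    case 1
    then show ?thesis
      using zero nonneg by blast
  next
    case 2
    then have "0 \<in> I"
      using ne nonneg by fastforce
    then show ?thesis
      using zero nonneg by blast
  next
    case (3 a)
    then show ?thesis
      using nonneg_part_greater_least[OF M, of a] by (metis IntD1 IntD2 IntI greaterThan_iff)
  next
    case (4 a b)
    obtain m where m: "m \<in> nonneg_part M" "a < m"
      "\<And>k. k \<in> nonneg_part M \<Longrightarrow> a < k \<Longrightarrow> m \<le> k"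
      using nonneg_part_greater_least[OF M, of a] by blast
    then have "m \<in> I"
      using ne 4 by fastforce
    then show ?thesis
      using m 4 by (intro bexI[of _ m]) auto
  next
    case 5
    then show ?thesis
      using ne by auto
  qed
qed

lemma nonneg_part_least:
  assumes M: "discretely_ordered_subring M" "integer_part M"
    and X: "finite_union_of_intervals_and_points X" and ne: "X \<inter> nonneg_part M \<noteq> {}"
  obtains m where "m \<in> X" "m \<in> nonneg_part M" "\<And>k. k \<in> X \<Longrightarrow> k \<in> nonneg_part M \<Longrightarrow> m \<le> k"
proof -
  obtain F where F: "finite F" "\<forall>I\<in>F. open_interval I \<or> (\<exists>a. I = {a})" "X = \<Union>F"
    using X by (auto simp: finite_union_of_intervals_and_points_def)
  \<comment> \<open>Only the pieces that meet M^+ have a least element there; the smallest of these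
    finitely many minima is the one sought.\<close>
  define G where "G = {I \<in> F. I \<inter> nonneg_part M \<noteq> {}}"
  have "\<forall>I\<in>G. \<exists>m \<in> I \<inter> nonneg_part M. \<forall>k \<in> I \<inter> nonneg_part M. m \<le> k"
    using F(2) by (auto simp only: G_def mem_Collect_eq intro!: nonneg_part_interval_least[OF M])
  then obtain f where f: "\<And>I. I \<in> G \<Longrightarrow> f I \<in> I \<inter> nonneg_part M"
    "\<And>I k. I \<in> G \<Longrightarrow> k \<in> I \<inter> nonneg_part M \<Longrightarrow> f I \<le> k"
    by metis
  have fin: "finite (f ` G)" and "f ` G \<noteq> {}"
    using F ne by (auto simp: G_def)
  then have "Min (f ` G) \<in> f ` G"
    by (rule Min_in)
  then obtain I where I: "I \<in> G" "Min (f ` G) = f I"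
    by auto
  show ?thesis
  proof (rule that)
    show "f I \<in> X" "f I \<in> nonneg_part M"
      using f(1)[OF I(1)] I(1) F(3) by (auto simp: G_def)
    fix k assume k: "k \<in> X" "k \<in> nonneg_part M"
    then obtain J where J: "J \<in> G" "k \<in> J"
      using F(3) by (auto simp: G_def)
    then have "f I \<le> f J"
      using I(2) fin by (metis Min_le imageI)
    also have "\<dots> \<le> k"
      using f(2) J k by blast
    finally show "f I \<le> k" .
  qed
qed

section \<open>Agreement of the two structures on M^+ and the induction scheme\<close>

lemma nonneg_structure_is_arith_structure:
  assumes "discretely_ordered_subring M" "pw \<in> nonneg_part M \<rightarrow> nonneg_part M \<rightarrow> nonneg_part M"
  shows "is_arith_structure (nonneg_structure M pw)"
  using assms by (auto simp: is_arith_structure_def nonneg_structure_def nonneg_part_def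
      discretely_ordered_subring_def)

lemma arith_val_nonneg_structure_eq_ext:
  assumes A: "is_arith_structure (nonneg_structure M pw)" and pw: "pow_integer_part E M pw"
    and v: "range v \<subseteq> nonneg_part M"
  shows "arith_val (nonneg_structure M pw) v t = arith_val (ext_structure E) v t"
proof (induction t)
  case (Pow t u)
  \<comment> \<open>The two powers are known to agree only for arguments in M^+, so the subterm
    values must be shown to stay there.\<close>
  have "arith_val (nonneg_structure M pw) v s \<in> nonneg_part M" for s
    using arith_val_in_dom[OF A] v by (simp add: nonneg_structure_def)
  then have "arith_val (ext_structure E) v t \<in> nonneg_part M"
    "arith_val (ext_structure E) v u \<in> nonneg_part M"
    using Pow by metis+
  then show ?case
    using Pow pw by (auto simp: nonneg_structure_def ext_structure_def pow_integer_part_def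
        nonneg_part_def order_le_less)
qed (simp_all add: nonneg_structure_def ext_structure_def)

lemma sat_nonneg_structure_eq_ext:
  assumes "is_arith_structure (nonneg_structure M pw)" "pow_integer_part E M pw"
    and "range v \<subseteq> nonneg_part M" "quantifier_free p"
  shows "sat U (arith_val (nonneg_structure M pw)) (\<le>) v p \<longleftrightarrow>
    sat U (arith_val (ext_structure E)) (\<le>) v p"
  using assms(4)
  by (induction p) (simp_all add: arith_val_nonneg_structure_eq_ext[OF assms(1-3)])

lemma sat_induction_axiom:
  assumes E: "exponential_field E" "o_minimal_exp E" and M: "discretely_ordered_subring M"
    and A: "is_arith_structure (nonneg_structure M pw)" and pw: "pow_integer_part E M pw"
    and v: "range v \<subseteq> nonneg_part M" and p: "quantifier_free p"
  shows "sat (nonneg_part M) (arith_val (nonneg_structure M pw)) (\<le>) v (induction_axiom p)"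
proof -
  let ?N = "nonneg_part M"
  let ?A = "nonneg_structure M pw"
  let ?P = "\<lambda>x. sat ?N (arith_val ?A) (\<le>) (case_nat x v) p"
  have int: "integer_part M"
    using pw by (simp add: pow_integer_part_def)
  obtain q where q: "\<And>v. sat UNIV (exp_tm_val E) (\<le>) v q \<longleftrightarrow>
      sat ?N (arith_val (ext_structure E)) (\<le>) v p"
    using sat_ext_structure_exp_definable[OF E(1) p] by metis
  \<comment> \<open>Counterexamples are collected in the whole field, with the entries of
    \<open>v\<close> as parameters, so that o-minimality applies.\<close>
  define X where "X = {a. sat UNIV (exp_tm_val E) (\<le>) (case_nat a v) (Neg q)}"
  have X: "finite_union_of_intervals_and_points X"
    using E(2) unfolding o_minimal_exp_def exp_definable_def X_def by blast
  have X_iff: "x \<in> X \<longleftrightarrow> \<not> ?P x" if "x \<in> ?N" for x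
  proof -
    have "range (case_nat x v) \<subseteq> ?N"
      using v that by (fastforce split: nat.splits)
    from sat_nonneg_structure_eq_ext[OF A pw this p] show ?thesis
      by (simp add: X_def q)
  qed
  have "?P x" if zero: "?P 0" and step: "\<And>x. x \<in> ?N \<Longrightarrow> ?P x \<Longrightarrow> ?P (x + 1)" and "x \<in> ?N" for x
  proof (rule ccontr)
    assume "\<not> ?P x"
    then have "X \<inter> ?N \<noteq> {}"
      using X_iff that by blast
    then obtain m where m: "m \<in> X" "m \<in> ?N" "\<And>k. k \<in> X \<Longrightarrow> k \<in> ?N \<Longrightarrow> m \<le> k"
      using nonneg_part_least[OF M int X] by metis
    then have "m \<noteq> 0"
      using X_iff zero by blast
    then have pred: "m - 1 \<in> ?N"
      using nonneg_part_diff_one[OF M m(2)] by simp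
    \<comment> \<open>Minimality of m makes the formula true at its predecessor, and the induction
      step then carries it to m.\<close>
    then have "m - 1 \<notin> X"
      using m(3)[of "m - 1"] by auto
    then have "?P (m - 1 + 1)"
      using step[OF pred] X_iff[OF pred] by blast
    then show False
      using X_iff m by simp
  qed
  \<comment> \<open>The assignments produced by the two substitutions put 0 and x + 1 in place of
    the induction variable, which turns the premises of the axiom into \<open>zero\<close> and
    \<open>step\<close>.\<close>
  moreover have "(\<lambda>i. arith_val ?A v (case_nat Zero Var i)) = case_nat 0 v"
    by (auto simp: nonneg_structure_def split: nat.split)
  moreover have "(\<lambda>i. arith_val ?A (case_nat x v)
      (case_nat (Succ (Var 0)) (\<lambda>i. Var (Suc i)) i)) = case_nat (x + 1) v" for x
    by (auto simp: nonneg_structure_def split: nat.split)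
  ultimately show ?thesis
    using p by (auto simp: induction_axiom_def sat_map_fm_arith_subst)
qed

section \<open>Verification of the axioms in M^+\<close>

theorem theorem2p4:
  fixes E :: "'a::linordered_field \<Rightarrow> 'a"
    and M :: "'a set"
    and pw :: "'a \<Rightarrow> 'a \<Rightarrow> 'a"
  assumes "exponential_field E"
    and "o_minimal_exp E"
    and "discretely_ordered_subring M"
    and "pw \<in> nonneg_part M \<rightarrow> nonneg_part M \<rightarrow> nonneg_part M"
    and "pow_integer_part E M pw"
  shows "arith_model (nonneg_structure M pw) IOpen_pow"
proof -
  let ?N = "nonneg_part M"
  let ?A = "nonneg_structure M pw"
  note E = exponential_field_laws[OF assms(1)]
  have A: "is_arith_structure ?A"
    using nonneg_structure_is_arith_structure[OF assms(3,4)] .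
  have nonneg: "0 \<le> x" if "x \<in> ?N" for x
    using that by (simp add: nonneg_part_def)
  have diff: "y - x \<in> ?N" if "x \<in> ?N" "y \<in> ?N" "x \<le> y" for x y
    using that discretely_ordered_subring_diff[OF assms(3)] by (simp add: nonneg_part_def)
  have pred: "\<exists>y\<in>?N. x = y + 1" if "x \<in> ?N" "x \<noteq> 0" for x
    using nonneg_part_diff_one[OF assms(3) that] by (intro bexI[of _ "x - 1"]) simp_all
  have le_iff: "x \<le> y \<longleftrightarrow> (\<exists>r\<in>?N. r + x = y)" if "x \<in> ?N" "y \<in> ?N" for x y
  proof
    assume "x \<le> y"
    then show "\<exists>r\<in>?N. r + x = y"
      using diff[OF that] by (intro bexI[of _ "y - x"]) simp_all
  next
    assume "\<exists>r\<in>?N. r + x = y"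
    then show "x \<le> y"
      using nonneg by auto
  qed
  \<comment> \<open>A positive x gives exp(0 * log x) = exp 0 = 1; the base 0 is the convention 0^0
    = 1.\<close>
  have pw_0: "pw x 0 = 1" if "x \<in> ?N" for x
    using that assms(3,5) E(1)
    by (cases "x = 0") (auto simp: pow_integer_part_def nonneg_part_def
        discretely_ordered_subring_def)
  have pw_Suc: "pw y (x + 1) = pw y x * y" if "x \<in> ?N" "y \<in> ?N" for x y
  proof -
    \<comment> \<open>Positivity of the exponent matters for base 0: both sides of the recursion are
      then 0, even when x = 0 and 0^x = 1.\<close>
    have x1: "x + 1 \<in> ?N" "0 < x + 1"
      using that assms(3) by (auto simp: nonneg_part_def discretely_ordered_subring_def
          add_nonneg_pos)
    show ?thesis
    proof (cases "y = 0")
      case True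
      then show ?thesis
        using x1 assms(5) by (auto simp: pow_integer_part_def nonneg_part_def)
    next
      case False
      then have "0 < y"
        using nonneg[OF that(2)] by simp
      \<comment> \<open>Here exp((x + 1) * log y) = exp(x * log y + log y) = exp(x * log y) *
        y.\<close>
      then show ?thesis
        using x1 that assms(5) E(3,5) by (simp add: pow_integer_part_def distrib_right)
    qed
  qed
  have "sat ?N (arith_val ?A) (\<le>) v p" if p: "p \<in> IOpen_pow" and v: "range v \<subseteq> ?N" for v p
  proof -
    have vi: "v i \<in> ?N" for i
      using v by auto
    have "v 0 + 1 \<noteq> 0"
      using nonneg[OF vi[of 0]] by (metis add_nonneg_pos less_irrefl zero_less_one)
    moreover have "sat ?N (arith_val ?A) (\<le>) v (induction_axiom p)" if "quantifier_free p" for p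
      using sat_induction_axiom[OF assms(1-3) A assms(5) v that] .
    \<comment> \<open>\<open>pred\<close> gives (Q3), \<open>le_iff\<close> gives (Q8), and
      \<open>pw_0\<close> and \<open>pw_Suc\<close> give (P1) and (P2); (Q1) is the inequality
      \<open>v 0 + 1 \<noteq> 0\<close>, and the remaining basic axioms are field identities or
      cancellation.\<close>
    ultimately show ?thesis
      using p vi pred[of "v 0"] le_iff[of "v 0" "v 1"] pw_0[of "v 0"] pw_Suc[of "v 0" "v 1"]
      unfolding IOpen_pow_def
      by (auto simp: nonneg_structure_def numeral_2_eq_2 algebra_simps)
  qed
  then show ?thesis
    using A by (simp add: arith_model_def nonneg_structure_def)
qed

end
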